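(* $\lambda_{2,1}(G)\le 4\Delta-1$ for every permutation graph $G$ with maximum degree $\Delta$. Thus, the greedy algorithm described in the context, for $L(2,1)$-labeling of permutation graphs, is a $4$-approximation algorithm.
   Context: All graphs are simple. For a graph $G=(V,E)$: $N_G(v)$ is the set of neighbors of $v$; $\Delta$ is the maximum degree; $d_G(u,v)$ is the length of a shortest path between $u$ and $v$. An $L(2,1)$-labeling of $G$ is a function $f:V\to\{0,1,2,\dots\}$ with $|f(u)-f(v)|\ge 2$ whenever $uv\in E$ and $|f(u)-f(v)|\ge 1$ whenever $d_G(u,v)=2$. Its span is the difference between the largest and the smallest label used. $\lambda_{2,1}(G)$ is the least integer $k$ such that $G$ has an $L(2,1)$-labeling with span $k$. A $4$-approximation algorithm is one that outputs an $L(2,1)$-labeling of span at most $4\lambda_{2,1}(G)$. $G$ is a permutation graph if each vertex $v$ can be assigned a closed interval $I_v$ of the real line so that distinct $u,v$ are adjacent iff $I_u\subseteq I_v$ or $I_v\subseteq I_u$; such an assignment is the interval representation meant here, and $r(v)$ denotes the right endpoint of $I_v$. Greedy algorithm. The input is a permutation graph $G$ with an ordering $(v_1,\dots,v_n)$ of its vertices such that $r(v_1)\le\cdots\le r(v_n)$ in an interval representation of $G$. Start with $S=\emptyset$. For $i=n,n-1,\dots,1$ in this order: let $f(v_i)$ be the smallest non-negative integer not in $$\bigcup_{v\in N_G(v_i)\cap S}\{f(v)-1,f(v),f(v)+1\}\ \cup\ \{f(u): u\in S,\ d_G(v_i,u)=2\},$$ and add $v_i$ to $S$. Output $f$.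
   Formalization: The bound λ ≤ 4Δ−1 is stated for permutation graphs with maximum degree Δ ≥ 1, since for edgeless graphs (Δ = 0) it would read 0 ≤ −1 and is false; the 4-approximation claim is stated for all permutation graphs. *)

theory Defs
  imports Complex_Main "HOL-Library.Extended_Nat"
begin

type_synonym 'a graph = "'a set \<times> 'a set set"

abbreviation verts :: "'a graph \<Rightarrow> 'a set" where "verts G \<equiv> fst G"
abbreviation edges :: "'a graph \<Rightarrow> 'a set set" where "edges G \<equiv> snd G"

definition simple_graph :: "'a graph \<Rightarrow> bool" where
  "simple_graph G \<longleftrightarrow> finite (verts G) \<and> (\<forall>e \<in> edges G. e \<subseteq> verts G \<and> card e = 2)"

definition neighbors :: "'a graph \<Rightarrow> 'a \<Rightarrow> 'a set" where
  "neighbors G v = {u \<in> verts G. {u, v} \<in> edges G}"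

text \<open>The graph without vertices is not excluded; its maximum degree is 0 by convention, and
  so is the span of its (empty) labeling below.\<close>

definition max_degree :: "'a graph \<Rightarrow> nat" where
  "max_degree G = (if verts G = {} then 0 else Max ((\<lambda>v. card (neighbors G v)) ` verts G))"

definition is_path :: "'a graph \<Rightarrow> 'a \<Rightarrow> 'a list \<Rightarrow> 'a \<Rightarrow> bool" where
  "is_path G u p v \<longleftrightarrow> p \<noteq> [] \<and> hd p = u \<and> last p = v \<and> distinct p \<and> set p \<subseteq> verts G \<and>
     successively (\<lambda>x y. {x, y} \<in> edges G) p"

text \<open>A path is given by its list of vertices, so its length is one less than the length of the
  list. The distance is infinite when no path exists.\<close>

definition graph_dist :: "'a graph \<Rightarrow> 'a \<Rightarrow> 'a \<Rightarrow> enat" where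
  "graph_dist G u v = (INF p \<in> {p. is_path G u p v}. enat (length p - 1))"

definition L21_labeling :: "'a graph \<Rightarrow> ('a \<Rightarrow> nat) \<Rightarrow> bool" where
  "L21_labeling G f \<longleftrightarrow>
     (\<forall>u \<in> verts G. \<forall>v \<in> verts G.
        ({u, v} \<in> edges G \<longrightarrow> \<bar>int (f u) - int (f v)\<bar> \<ge> 2) \<and>
        (graph_dist G u v = 2 \<longrightarrow> \<bar>int (f u) - int (f v)\<bar> \<ge> 1))"

definition label_span :: "'a graph \<Rightarrow> ('a \<Rightarrow> nat) \<Rightarrow> nat" where
  "label_span G f = (if verts G = {} then 0 else Max (f ` verts G) - Min (f ` verts G))"

definition lambda21 :: "'a graph \<Rightarrow> nat" where
  "lambda21 G = (LEAST k. \<exists>f. L21_labeling G f \<and> label_span G f = k)"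

text \<open>Vertex \<open>v\<close> is assigned the nonempty closed interval from \<open>l v\<close> to \<open>r v\<close>.\<close>

definition interval_representation ::
    "'a graph \<Rightarrow> ('a \<Rightarrow> real) \<Rightarrow> ('a \<Rightarrow> real) \<Rightarrow> bool" where
  "interval_representation G l r \<longleftrightarrow>
     (\<forall>v \<in> verts G. l v \<le> r v) \<and>
     (\<forall>u \<in> verts G. \<forall>v \<in> verts G. u \<noteq> v \<longrightarrow>
        ({u, v} \<in> edges G \<longleftrightarrow>
           {l u..r u} \<subseteq> {l v..r v} \<or> {l v..r v} \<subseteq> {l u..r u}))"

definition permutation_graph :: "'a graph \<Rightarrow> bool" where
  "permutation_graph G \<longleftrightarrow> simple_graph G \<and> (\<exists>l r. interval_representation G l r)"

definition right_endpoint_ordering :: "'a graph \<Rightarrow> 'a list \<Rightarrow> bool" where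
  "right_endpoint_ordering G vs \<longleftrightarrow> distinct vs \<and> set vs = verts G \<and>
     (\<exists>l r. interval_representation G l r \<and> sorted (map r vs))"

text \<open>The forbidden labels are integers, as \<open>f v - 1\<close> may be \<open>-1\<close>.\<close>

definition forbidden_labels :: "'a graph \<Rightarrow> ('a \<Rightarrow> nat) \<Rightarrow> 'a set \<Rightarrow> 'a \<Rightarrow> int set" where
  "forbidden_labels G f S x =
     (\<Union>v \<in> neighbors G x \<inter> S. {int (f v) - 1, int (f v), int (f v) + 1}) \<union>
     {int (f u) | u. u \<in> S \<and> graph_dist G x u = 2}"

fun greedy_step :: "'a graph \<Rightarrow> 'a \<Rightarrow> ('a \<Rightarrow> nat) \<times> 'a set \<Rightarrow> ('a \<Rightarrow> nat) \<times> 'a set" where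
  "greedy_step G x (f, S) = (f(x := (LEAST k. int k \<notin> forbidden_labels G f S x)), insert x S)"

text \<open>\<open>foldr\<close> processes the vertices from the last one of the list to the first one. The initial
  labeling \<open>\<lambda>_. 0\<close> is only a placeholder: a label is read only after it has been assigned.\<close>

definition greedy :: "'a graph \<Rightarrow> 'a list \<Rightarrow> 'a \<Rightarrow> nat" where
  "greedy G vs = fst (foldr (greedy_step G) vs (\<lambda>_. 0, {}))"

text \<open>The algorithms considered take a permutation graph together with an ordering of its vertices
  by right endpoints.\<close>

definition approximation_algorithm :: "nat \<Rightarrow> ('a graph \<Rightarrow> 'a list \<Rightarrow> 'a \<Rightarrow> nat) \<Rightarrow> bool" where
  "approximation_algorithm c A \<longleftrightarrow>
     (\<forall>G vs. permutation_graph G \<and> right_endpoint_ordering G vs \<longrightarrow>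
        L21_labeling G (A G vs) \<and> label_span G (A G vs) \<le> c * lambda21 G)"

end

theory Submission imports Defs begin

text \<open>When the greedy algorithm reaches \<open>x\<close>, every vertex of \<open>S\<close> has a right endpoint at least
  \<open>r x\<close>, so a vertex \<open>u \<in> S\<close> at distance 2 lies strictly to the right of \<open>x\<close> at both endpoints. A
  common neighbor of \<open>x\<close> and \<open>u\<close> either contains both intervals or is contained in both. In the
  first case \<open>u\<close> is adjacent to the interval containing \<open>x\<close> with the largest right endpoint, which
  leaves at most \<open>\<Delta> - 1\<close> such \<open>u\<close>. In the second case \<open>u\<close> is adjacent to the interval inside \<open>x\<close>
  with the largest left endpoint; this one is also adjacent to \<open>x\<close> and to all other neighbors of
  \<open>x\<close> in \<open>S\<close>. If there are \<open>d\<close> of these, at most \<open>\<Delta> - d\<close> such \<open>u\<close> remain. Hence at most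
  \<open>3 d + (\<Delta> - 1) + (\<Delta> - d) \<le> 4 \<Delta> - 1\<close> labels are forbidden. Conversely \<open>\<lambda> \<ge> \<Delta>\<close>, since the
  labels on a closed neighborhood are distinct.\<close>

section \<open>Degrees and pairs at distance 2\<close>

lemma edge_distinct: "simple_graph G \<Longrightarrow> {u, v} \<in> edges G \<Longrightarrow> u \<noteq> v"
  by (auto simp: simple_graph_def)

lemma finite_neighbors: "simple_graph G \<Longrightarrow> finite (neighbors G v)"
  by (simp add: simple_graph_def neighbors_def)

lemma card_neighbors_le_max_degree:
  assumes "simple_graph G" and "v \<in> verts G"
  shows "card (neighbors G v) \<le> max_degree G"
proof -
  have "finite (verts G)" using assms(1) by (simp add: simple_graph_def)
  with assms(2) show ?thesis by (auto simp: max_degree_def intro!: Max_ge)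
qed

text \<open>This replaces path lists and infima by a local condition. The condition is visibly
  symmetric in \<open>u\<close> and \<open>v\<close>, which the greedy invariant needs
  later.\<close>

lemma graph_dist_eq_2_iff:
  assumes "simple_graph G" and uv: "u \<in> verts G" "v \<in> verts G"
  shows "graph_dist G u v = 2 \<longleftrightarrow>
    u \<noteq> v \<and> {u, v} \<notin> edges G \<and> (\<exists>w \<in> verts G. {u, w} \<in> edges G \<and> {w, v} \<in> edges G)"
proof
  assume d: "graph_dist G u v = 2"
  let ?L = "(\<lambda>p. enat (length p - 1)) ` {p. is_path G u p v}"
  \<comment> \<open>The infimum over no paths is infinite, so distance 2 guarantees a path. Since
    \<open>enat\<close> is well-ordered, the infimum is attained by one of them.\<close>
  have "?L \<noteq> {}"
  proof
    assume "?L = {}"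
    then have "graph_dist G u v = \<infinity>" by (simp add: graph_dist_def Inf_enat_def)
    with d show False by simp
  qed
  then have "graph_dist G u v \<in> ?L"
    unfolding graph_dist_def by (meson Inf_enat_def LeastI ex_in_conv wellorder_InfI)
  then obtain p where p: "is_path G u p v" and "enat (length p - 1) = 2"
    using d by auto
  then have "length p = 3"
    by (simp add: numeral_eq_enat is_path_def)
  then obtain a w b where pabc: "p = [a, w, b]"
    by (auto simp: numeral_3_eq_3 length_Suc_conv)
  have "{u, v} \<notin> edges G"
  proof
    assume "{u, v} \<in> edges G"
    then have "is_path G u [u, v] v"
      using assms edge_distinct[of G u v] by (auto simp: is_path_def)
    then have "graph_dist G u v \<le> enat (length [u, v] - 1)"
      unfolding graph_dist_def by (intro INF_lower) simp
    with d show False by (simp add: numeral_eq_enat)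
  qed
  with p pabc show "u \<noteq> v \<and> {u, v} \<notin> edges G \<and>
      (\<exists>w \<in> verts G. {u, w} \<in> edges G \<and> {w, v} \<in> edges G)"
    by (auto simp: is_path_def)
next
  assume R: "u \<noteq> v \<and> {u, v} \<notin> edges G \<and>
    (\<exists>w \<in> verts G. {u, w} \<in> edges G \<and> {w, v} \<in> edges G)"
  then obtain w where w: "w \<in> verts G" "{u, w} \<in> edges G" "{w, v} \<in> edges G" by blast
  have "is_path G u [u, w, v] v"
    using assms w R edge_distinct[of G u w] edge_distinct[of G w v] by (auto simp: is_path_def)
  then have "graph_dist G u v \<le> enat (length [u, w, v] - 1)"
    unfolding graph_dist_def by (intro INF_lower) simp
  then have upper: "graph_dist G u v \<le> 2" by (simp add: numeral_eq_enat numeral_2_eq_2)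
  \<comment> \<open>A path on one vertex would force \<open>u = v\<close>, and a path on two
    vertices would be the edge that is excluded.\<close>
  have "2 \<le> length p - 1" if "is_path G u p v" for p
  proof (rule ccontr)
    assume "\<not> 2 \<le> length p - 1"
    moreover have "length p \<noteq> 0" using that by (simp add: is_path_def)
    ultimately have "length p = Suc 0 \<or> length p = Suc (Suc 0)" by linarith
    with that R show False
      by (auto simp: is_path_def length_Suc_conv)
  qed
  then have "2 \<le> graph_dist G u v"
    unfolding graph_dist_def by (intro INF_greatest) (simp add: numeral_eq_enat)
  with upper show "graph_dist G u v = 2" by simp
qed

section \<open>Interval geometry and the count of forbidden labels\<close>

lemma interval_adjacent_iff:
  assumes "interval_representation G l r" "u \<in> verts G" "v \<in> verts G" "u \<noteq> v"
  shows "{u, v} \<in> edges G \<longleftrightarrow>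
    (l v \<le> l u \<and> r u \<le> r v) \<or> (l u \<le> l v \<and> r v \<le> r u)"
proof -
  \<comment> \<open>An empty interval would be a subset of everything; nonemptiness turns inclusion
    into a comparison of endpoints.\<close>
  have "l u \<le> r u" "l v \<le> r v"
    using assms by (auto simp: interval_representation_def)
  moreover have "{u, v} \<in> edges G \<longleftrightarrow>
      {l u..r u} \<subseteq> {l v..r v} \<or> {l v..r v} \<subseteq> {l u..r u}"
    using assms by (auto simp: interval_representation_def)
  ultimately show ?thesis by auto
qed

lemma exists_maximal_on_finite:
  fixes h :: "'a \<Rightarrow> 'b::linorder"
  assumes "finite C" "C \<noteq> {}"
  obtains w where "w \<in> C" "\<And>c. c \<in> C \<Longrightarrow> h c \<le> h w"
  using Max_in[of "h ` C"] Max_ge[of "h ` C"] assms by fastforce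

lemma card_distance_2_via_container:
  assumes sg: "simple_graph G" and rep: "interval_representation G l r"
    and x: "x \<in> verts G" and A: "A \<subseteq> verts G"
    and right: "\<And>u. u \<in> A \<Longrightarrow> l x < l u \<and> r x < r u"
    and via: "\<And>u. u \<in> A \<Longrightarrow> \<exists>w \<in> neighbors G x. l w \<le> l x \<and> r u \<le> r w"
  shows "card A \<le> max_degree G - 1"
proof (cases "A = {}")
  case False
  define C where "C = {w \<in> neighbors G x. l w \<le> l x}"
  have "C \<noteq> {}" using False via by (auto simp: C_def)
  moreover have "finite C" using finite_neighbors[OF sg] by (simp add: C_def)
  ultimately obtain w where w: "w \<in> C" and wmax: "\<And>c. c \<in> C \<Longrightarrow> r c \<le> r w"
    using exists_maximal_on_finite[of C r] by blast
  have wv: "w \<in> verts G" "{w, x} \<in> edges G" "l w \<le> l x"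
    using w by (auto simp: C_def neighbors_def insert_commute)
  have "insert x A \<subseteq> neighbors G w"
  proof
    fix u assume u: "u \<in> insert x A"
    show "u \<in> neighbors G w"
    proof (cases "u = x")
      case False
      with u have uA: "u \<in> A" by simp
      obtain c where "c \<in> C" "r u \<le> r c" using via[OF uA] by (auto simp: C_def)
      then have "r u \<le> r w" using wmax by fastforce
      moreover have "l w < l u" using right[OF uA] wv by simp
      moreover have "u \<in> verts G" using uA A by blast
      ultimately show ?thesis
        using interval_adjacent_iff[OF rep wv(1), of u]
        by (auto simp: neighbors_def insert_commute)
    qed (use wv x in \<open>simp add: neighbors_def insert_commute\<close>)
  qed
  \<comment> \<open>\<open>x\<close> itself takes one of the neighbor slots of \<open>w\<close>;
    this is the source of the \<open>- 1\<close>.\<close>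
  then have "card (insert x A) \<le> max_degree G"
    using card_mono[OF finite_neighbors[OF sg]] card_neighbors_le_max_degree[OF sg wv(1)]
    by (meson le_trans)
  moreover have "finite A" using A sg finite_subset by (auto simp: simple_graph_def)
  moreover have "x \<notin> A" using right by blast
  ultimately show ?thesis by simp
qed simp

text \<open>Among the neighbors contained in \<open>x\<close>, the one with the largest left
  endpoint, \<open>w\<close>, sees \<open>x\<close>, \<open>B\<close> and \<open>D - {w}\<close>.
  With tied right endpoints \<open>w\<close> may itself lie in \<open>D\<close>; the slot lost this
  way is paid for by the slot of \<open>x\<close>, so the bound has no further
  \<open>- 1\<close>.\<close>

lemma card_distance_2_via_contained:
  assumes sg: "simple_graph G" and rep: "interval_representation G l r"
    and x: "x \<in> verts G" and B: "B \<subseteq> verts G" and D: "D \<subseteq> neighbors G x"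
    and Dright: "\<And>u. u \<in> D \<Longrightarrow> r x \<le> r u"
    and right: "\<And>u. u \<in> B \<Longrightarrow> l x < l u \<and> r x < r u"
    and nonadjacent: "B \<inter> neighbors G x = {}"
    and via: "\<And>u. u \<in> B \<Longrightarrow> \<exists>w \<in> neighbors G x. r w \<le> r x \<and> l u \<le> l w"
  shows "card B \<le> max_degree G - card D"
proof (cases "B = {}")
  case False
  define C where "C = {w \<in> neighbors G x. l x \<le> l w \<and> r w \<le> r x}"
  have "C \<noteq> {}" using False via right by (force simp: C_def)
  moreover have "finite C" using finite_neighbors[OF sg] by (simp add: C_def)
  ultimately obtain w where w: "w \<in> C" and wmax: "\<And>c. c \<in> C \<Longrightarrow> l c \<le> l w"
    using exists_maximal_on_finite[of C l] by blast
  have wv: "w \<in> verts G" "{w, x} \<in> edges G" "l x \<le> l w" "r w \<le> r x"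
    using w by (auto simp: C_def neighbors_def insert_commute)
  \<comment> \<open>Otherwise \<open>l x < l u\<close>, and maximality of \<open>w\<close> keeps
    \<open>u\<close> out of \<open>C\<close>, so \<open>r x < r u\<close>. Then neither of
    \<open>u\<close> and \<open>x\<close> contains the other, although they are adjacent.\<close>
  have Dl: "l u \<le> l w" if u: "u \<in> D" for u
  proof (rule ccontr)
    assume n: "\<not> l u \<le> l w"
    then have "u \<notin> C" using wmax by blast
    then have "r x < r u" using u D wv n by (auto simp: C_def)
    moreover have "u \<in> verts G" "{u, x} \<in> edges G"
      using u D by (auto simp: neighbors_def insert_commute)
    moreover have "u \<noteq> x" using edge_distinct[OF sg] calculation by blast
    ultimately show False
      using interval_adjacent_iff[OF rep, of u x] x n wv by auto
  qed
  have "insert x (B \<union> (D - {w})) \<subseteq> neighbors G w"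
  proof
    fix u assume u: "u \<in> insert x (B \<union> (D - {w}))"
    consider "u = x" | "u \<in> B" | "u \<in> D" "u \<noteq> w" using u by blast
    then show "u \<in> neighbors G w"
    proof cases
      case 1
      then show ?thesis using wv x by (simp add: neighbors_def insert_commute)
    next
      case 2
      obtain c where c: "c \<in> neighbors G x" "r c \<le> r x" "l u \<le> l c" using via[OF 2] by blast
      then have "c \<in> C" using right[OF 2] by (auto simp: C_def)
      then have "l u \<le> l w" using wmax c by fastforce
      moreover have "r w < r u" using right[OF 2] wv by simp
      moreover have "u \<in> verts G" using 2 B by blast
      ultimately show ?thesis
        using interval_adjacent_iff[OF rep wv(1), of u]
        by (auto simp: neighbors_def insert_commute)
    next
      case 3
      moreover have "u \<in> verts G" using 3 D by (auto simp: neighbors_def)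
      moreover have "r w \<le> r u" using Dright[OF 3(1)] wv by simp
      ultimately show ?thesis
        using Dl[OF 3(1)] interval_adjacent_iff[OF rep wv(1), of u]
        by (auto simp: neighbors_def insert_commute)
    qed
  qed
  then have le: "card (insert x (B \<union> (D - {w}))) \<le> max_degree G"
    using card_mono[OF finite_neighbors[OF sg]] card_neighbors_le_max_degree[OF sg wv(1)]
    by (meson le_trans)
  have fin: "finite B" "finite D"
    using B D sg finite_subset finite_neighbors[OF sg, of x] by (auto simp: simple_graph_def)
  have "x \<notin> neighbors G x" using edge_distinct[OF sg, of x x] by (auto simp: neighbors_def)
  then have "x \<notin> B \<union> (D - {w})" using right D by blast
  then have "card (insert x (B \<union> (D - {w}))) = Suc (card B + card (D - {w}))"
    using fin nonadjacent D by (subst card_insert_disjoint) (auto intro!: card_Un_disjoint)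
  moreover have "card D \<le> Suc (card (D - {w}))"
    using card_Suc_Diff1[OF fin(2), of w] by (cases "w \<in> D") auto
  ultimately show ?thesis using le by linarith
qed simp

lemma forbidden_labels_bound:
  assumes sg: "simple_graph G" and rep: "interval_representation G l r"
    and x: "x \<in> verts G" "x \<notin> S" and S: "S \<subseteq> verts G"
    and Sright: "\<And>u. u \<in> S \<Longrightarrow> r x \<le> r u"
  shows "finite (forbidden_labels G f S x)"
    and "card (forbidden_labels G f S x) \<le> 4 * max_degree G - 1"
proof -
  let ?N = "neighbors G x"
  define D where "D = ?N \<inter> S"
  define T where "T = {u \<in> S. graph_dist G x u = 2}"
  define A where "A = {u \<in> T. \<exists>w \<in> ?N. l w \<le> l x \<and> r u \<le> r w}"
  define B where "B = {u \<in> T. \<exists>w \<in> ?N. r w \<le> r x \<and> l u \<le> l w}"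
  have T: "u \<in> verts G \<and> u \<noteq> x \<and> {x, u} \<notin> edges G \<and>
      (\<exists>w \<in> verts G. {x, w} \<in> edges G \<and> {w, u} \<in> edges G)" if "u \<in> T" for u
    using that S graph_dist_eq_2_iff[OF sg x(1), of u] by (auto simp: T_def)
  \<comment> \<open>Equality of the right endpoints, or \<open>l u \<le> l x\<close>, would nest the
    two intervals and make \<open>u\<close> adjacent to \<open>x\<close>.\<close>
  have Tright: "l x < l u \<and> r x < r u" if u: "u \<in> T" for u
  proof -
    have "r x \<le> r u" using u Sright by (simp add: T_def)
    then show ?thesis using T[OF u] interval_adjacent_iff[OF rep x(1), of u] by force
  qed
  have "T \<subseteq> A \<union> B"
  proof
    fix u assume u: "u \<in> T"
    obtain w where w: "w \<in> verts G" "{x, w} \<in> edges G" "{w, u} \<in> edges G" using T[OF u] by blast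
    have "x \<noteq> w" "w \<noteq> u" using w edge_distinct[OF sg] by auto
    then have "(l w \<le> l x \<and> r x \<le> r w) \<or> (l x \<le> l w \<and> r w \<le> r x)"
      "(l w \<le> l u \<and> r u \<le> r w) \<or> (l u \<le> l w \<and> r w \<le> r u)"
      using w T[OF u] interval_adjacent_iff[OF rep x(1), of w]
        interval_adjacent_iff[OF rep w(1), of u] by auto
    \<comment> \<open>The mixed cases, with \<open>w\<close> between \<open>x\<close> and
      \<open>u\<close> in the inclusion order, would nest \<open>x\<close> and \<open>u\<close> by
      transitivity.\<close>
    then have "(l w \<le> l x \<and> r u \<le> r w) \<or> (r w \<le> r x \<and> l u \<le> l w)"
      using Tright[OF u] by linarith
    moreover have "w \<in> ?N" using w by (simp add: neighbors_def insert_commute)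
    ultimately show "u \<in> A \<union> B" using u by (auto simp: A_def B_def)
  qed
  moreover have finS: "finite S" using S sg finite_subset by (auto simp: simple_graph_def)
  then have finAB: "finite A" "finite B" by (auto simp: A_def B_def T_def)
  ultimately have "card T \<le> card A + card B"
    by (meson card_Un_le card_mono finite_UnI le_trans)
  moreover have "card A \<le> max_degree G - 1"
    using T Tright by (intro card_distance_2_via_container[OF sg rep x(1)]) (auto simp: A_def)
  moreover have "card B \<le> max_degree G - card D"
  proof (rule card_distance_2_via_contained[OF sg rep x(1)])
    show "B \<inter> ?N = {}" using T by (auto simp: B_def neighbors_def insert_commute)
  qed (use T Tright Sright in \<open>auto simp: B_def D_def\<close>)
  \<comment> \<open>Besides bounding \<open>2 * card D\<close>, this keeps the truncated difference
    \<open>max_degree G - card D\<close> exact. For maximum degree 0 all the counts vanish.\<close>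
  moreover have "card D \<le> max_degree G"
    using card_mono[OF finite_neighbors[OF sg, of x], of D]
      card_neighbors_le_max_degree[OF sg x(1)] by (simp add: D_def)
  ultimately have count: "3 * card D + card T \<le> 4 * max_degree G - 1" by linarith
  let ?F = "\<lambda>v. {int (f v) - 1, int (f v), int (f v) + 1}"
  have eq: "forbidden_labels G f S x = (\<Union>v \<in> D. ?F v) \<union> (\<lambda>u. int (f u)) ` T"
    by (auto simp: forbidden_labels_def D_def T_def)
  have fin: "finite D" "finite T" using finS by (auto simp: D_def T_def)
  then show "finite (forbidden_labels G f S x)" by (simp add: eq)
  have "card (\<Union>v \<in> D. ?F v) \<le> (\<Sum>v \<in> D. card (?F v))" by (rule card_UN_le[OF fin(1)])
  also have "\<dots> \<le> (\<Sum>v \<in> D. 3)" by (intro sum_mono) (simp add: card_insert_if)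
  finally have "card (\<Union>v \<in> D. ?F v) \<le> 3 * card D" by simp
  moreover have "card ((\<lambda>u. int (f u)) ` T) \<le> card T" by (rule card_image_le[OF fin(2)])
  ultimately show "card (forbidden_labels G f S x) \<le> 4 * max_degree G - 1"
    using count card_Un_le[of "\<Union>v \<in> D. ?F v" "(\<lambda>u. int (f u)) ` T"] unfolding eq by linarith
qed

section \<open>Correctness and span of the greedy labeling\<close>

lemma Least_not_in_finite:
  fixes F :: "int set"
  assumes "finite F"
  shows "int (LEAST k. int k \<notin> F) \<notin> F" and "(LEAST k. int k \<notin> F) \<le> card F"
proof -
  have "\<exists>k \<le> card F. int k \<notin> F"
  proof (rule ccontr)
    assume "\<not> ?thesis"
    \<comment> \<open>Pigeonhole: labels start at 0, so there are \<open>card F + 1\<close>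
      candidates up to \<open>card F\<close>. Hence a bound on the number of forbidden labels bounds
      the label itself, without an extra 1.\<close>
    then have "int ` {..card F} \<subseteq> F" by auto
    then have "card (int ` {..card F}) \<le> card F" by (rule card_mono[OF assms])
    then show False by (simp add: card_image)
  qed
  then obtain k where "k \<le> card F" "int k \<notin> F" by blast
  then show "int (LEAST k. int k \<notin> F) \<notin> F" "(LEAST k. int k \<notin> F) \<le> card F"
    using LeastI[of "\<lambda>k. int k \<notin> F"] Least_le[of "\<lambda>k. int k \<notin> F" k] by simp_all
qed

text \<open>Conflicts are required to be resolved only inside \<open>S\<close>, but distances are
  taken in all of \<open>G\<close>: a common neighbor may still be unlabeled. For
  \<open>S = verts G\<close> this is \<open>L21_labeling\<close>.\<close>

lemma greedy_invariant:
  assumes sg: "simple_graph G" and rep: "interval_representation G l r"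
    and "distinct vs" "set vs \<subseteq> verts G" "sorted (map r vs)"
    and "foldr (greedy_step G) vs (\<lambda>_. 0, {}) = (f, S)"
  shows "S = set vs \<and> (\<forall>u \<in> S. f u \<le> 4 * max_degree G - 1) \<and>
    (\<forall>u \<in> S. \<forall>v \<in> S.
      ({u, v} \<in> edges G \<longrightarrow> \<bar>int (f u) - int (f v)\<bar> \<ge> 2) \<and>
      (graph_dist G u v = 2 \<longrightarrow> \<bar>int (f u) - int (f v)\<bar> \<ge> 1))"
  using assms(3-)
proof (induction vs arbitrary: f S)
  case Nil
  then show ?case by simp
next
  case (Cons x vs)
  obtain g S' where g: "foldr (greedy_step G) vs (\<lambda>_. 0, {}) = (g, S')" by (rule prod.exhaust)
  define F where "F = forbidden_labels G g S' x"
  define k where "k = (LEAST k. int k \<notin> F)"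
  have f: "f = g(x := k)" and S: "S = insert x S'"
    using Cons.prems(4) g by (auto simp: k_def F_def)
  have IH: "S' = set vs" "\<And>u. u \<in> S' \<Longrightarrow> g u \<le> 4 * max_degree G - 1"
    "\<And>u v. u \<in> S' \<Longrightarrow> v \<in> S' \<Longrightarrow> {u, v} \<in> edges G \<Longrightarrow> \<bar>int (g u) - int (g v)\<bar> \<ge> 2"
    "\<And>u v. u \<in> S' \<Longrightarrow> v \<in> S' \<Longrightarrow> graph_dist G u v = 2 \<Longrightarrow> \<bar>int (g u) - int (g v)\<bar> \<ge> 1"
    using Cons.IH[OF _ _ _ g] Cons.prems by simp_all
  have x: "x \<in> verts G" "x \<notin> S'" "S' \<subseteq> verts G" using Cons.prems IH(1) by auto
  \<comment> \<open>\<open>foldr\<close> handles the head after the tail, so \<open>S'\<close> is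
    the tail, and sortedness puts its right endpoints at or beyond that of \<open>x\<close>.\<close>
  have "\<And>u. u \<in> S' \<Longrightarrow> r x \<le> r u" using Cons.prems IH(1) by simp
  note F = forbidden_labels_bound[OF sg rep x this, of g, folded F_def]
  have kF: "int k \<notin> F" and "k \<le> 4 * max_degree G - 1"
    using Least_not_in_finite[OF F(1)] F(2) by (auto simp: k_def)
  have adj: "\<bar>int k - int (g v)\<bar> \<ge> 2" if "v \<in> S'" "{x, v} \<in> edges G" for v
  proof -
    have "v \<in> neighbors G x \<inter> S'" using that x by (auto simp: neighbors_def insert_commute)
    then have "int k \<notin> {int (g v) - 1, int (g v), int (g v) + 1}"
      using kF by (auto simp: F_def forbidden_labels_def)
    then show ?thesis by auto
  qed
  have dist2: "\<bar>int k - int (g v)\<bar> \<ge> 1" if "v \<in> S'" "graph_dist G x v = 2" for v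
  proof -
    have "int k \<noteq> int (g v)" using kF that by (auto simp: F_def forbidden_labels_def)
    then show ?thesis by auto
  qed
  have sym: "graph_dist G x v = 2" if "v \<in> S'" "graph_dist G v x = 2" for v
    using that x graph_dist_eq_2_iff[OF sg, of x v] graph_dist_eq_2_iff[OF sg, of v x]
    by (auto simp: insert_commute)
  have irrefl: "{x} \<notin> edges G" "graph_dist G x x \<noteq> 2"
    using edge_distinct[OF sg, of x x] graph_dist_eq_2_iff[OF sg x(1) x(1)] by auto
  have "({u, v} \<in> edges G \<longrightarrow> \<bar>int (f u) - int (f v)\<bar> \<ge> 2) \<and>
      (graph_dist G u v = 2 \<longrightarrow> \<bar>int (f u) - int (f v)\<bar> \<ge> 1)"
    if "u \<in> S" "v \<in> S" for u v
  proof (cases "u = x"; cases "v = x")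
    assume "u = x" "v = x"
    then show ?thesis using irrefl by simp
  next
    assume "u = x" "v \<noteq> x"
    then show ?thesis using that adj dist2 by (simp add: f S)
  next
    assume "u \<noteq> x" "v = x"
    then show ?thesis using that adj[of u] dist2[of u] sym[of u]
      by (simp add: f S insert_commute abs_minus_commute)
  next
    assume "u \<noteq> x" "v \<noteq> x"
    then show ?thesis using that IH(3,4) by (simp add: f S)
  qed
  moreover have "\<forall>u \<in> S. f u \<le> 4 * max_degree G - 1"
    using IH(2) \<open>k \<le> _\<close> by (auto simp: f S)
  moreover have "S = set (x # vs)" by (simp add: S IH(1))
  ultimately show ?case by blast
qed

lemma greedy_L21_labeling:
  assumes "simple_graph G" "right_endpoint_ordering G vs"
  shows "L21_labeling G (greedy G vs)"
    and "label_span G (greedy G vs) \<le> 4 * max_degree G - 1"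
proof -
  obtain f S where fS: "foldr (greedy_step G) vs (\<lambda>_. 0, {}) = (f, S)" by (rule prod.exhaust)
  obtain l r where "interval_representation G l r" "sorted (map r vs)" "distinct vs"
    and vs: "set vs = verts G"
    using assms(2) by (auto simp: right_endpoint_ordering_def)
  note inv = greedy_invariant[OF assms(1) this(1,3) _ this(2) fS]
  have g: "greedy G vs = f" by (simp add: greedy_def fS)
  show "L21_labeling G (greedy G vs)" using inv vs by (auto simp: g L21_labeling_def)
  have "finite (verts G)" using assms(1) by (simp add: simple_graph_def)
  \<comment> \<open>The span never exceeds the largest label, so the smallest one can be
    ignored.\<close>
  then have "Max (f ` verts G) \<le> 4 * max_degree G - 1" if "verts G \<noteq> {}"
    using inv vs that by simp
  then show "label_span G (greedy G vs) \<le> 4 * max_degree G - 1"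
    by (cases "verts G = {}") (simp_all add: g label_span_def)
qed

section \<open>Lower bound on the optimum and the approximation ratio\<close>

lemma max_degree_le_label_span:
  assumes sg: "simple_graph G" and f: "L21_labeling G f"
  shows "max_degree G \<le> label_span G f"
proof (cases "verts G = {}")
  case True
  then show ?thesis by (simp add: max_degree_def)
next
  case False
  have fin: "finite (verts G)" using sg by (simp add: simple_graph_def)
  then have "max_degree G \<in> (\<lambda>v. card (neighbors G v)) ` verts G"
    using False Max_in[of "(\<lambda>v. card (neighbors G v)) ` verts G"] by (simp add: max_degree_def)
  then obtain v where v: "v \<in> verts G" "max_degree G = card (neighbors G v)" by blast
  let ?N = "insert v (neighbors G v)"
  have sub: "?N \<subseteq> verts G" using v by (auto simp: neighbors_def)
  have "inj_on f ?N"
  proof (rule inj_onI, rule ccontr)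
    fix a b assume ab: "a \<in> ?N" "b \<in> ?N" "f a = f b" "a \<noteq> b"
    have in_V: "a \<in> verts G" "b \<in> verts G" using ab sub by auto
    then have nonadj: "{a, b} \<notin> edges G" "graph_dist G a b \<noteq> 2"
      using f ab(3) by (force simp: L21_labeling_def)+
    \<comment> \<open>Neither \<open>a\<close> nor \<open>b\<close> can be \<open>v\<close>, as they
      would then be adjacent. So \<open>v\<close> is a common neighbor, which forces distance
      2.\<close>
    then have "{a, v} \<in> edges G" "{v, b} \<in> edges G"
      using ab by (auto simp: neighbors_def insert_commute)
    then show False using nonadj ab(4) v(1) graph_dist_eq_2_iff[OF sg in_V] by blast
  qed
  then have "card (f ` ?N) = card ?N" by (rule card_image)
  also have "\<dots> = Suc (max_degree G)"
    using edge_distinct[OF sg, of v v] finite_neighbors[OF sg] v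
    by (subst card_insert_disjoint) (auto simp: neighbors_def)
  finally have "Suc (max_degree G) = card (f ` ?N)" by simp
  \<comment> \<open>A range of span \<open>s\<close> holds \<open>s + 1\<close> integers, which
    absorbs the \<open>Suc\<close>.\<close>
  also have "\<dots> \<le> card {Min (f ` verts G)..Max (f ` verts G)}"
    using fin sub by (intro card_mono) auto
  finally show ?thesis using False by (simp add: label_span_def)
qed

lemma lambda21_le_label_span: "L21_labeling G f \<Longrightarrow> lambda21 G \<le> label_span G f"
  unfolding lambda21_def by (rule Least_le) blast

text \<open>\<open>LEAST\<close> is meaningful only if some labeling exists; the greedy output later
  supplies one.\<close>

lemma lambda21_attained:
  assumes "L21_labeling G f"
  obtains g where "L21_labeling G g" "label_span G g = lambda21 G"
  using LeastI[of "\<lambda>k. \<exists>f. L21_labeling G f \<and> label_span G f = k" "label_span G f"] assms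
  unfolding lambda21_def by blast

text \<open>The bound on \<open>lambda21\<close> mentions no ordering, so one is made by sorting, in
  order to run the greedy algorithm.\<close>

lemma permutation_graph_ordering:
  assumes "permutation_graph G"
  obtains vs where "right_endpoint_ordering G vs"
proof -
  obtain l r where rep: "interval_representation G l r" and "finite (verts G)"
    using assms by (auto simp: permutation_graph_def simple_graph_def)
  then obtain xs where "set xs = verts G" "distinct xs"
    using finite_distinct_list by blast
  then have "right_endpoint_ordering G (sort_key r xs)"
    unfolding right_endpoint_ordering_def using rep sorted_sort_key[of r xs]
    by (metis distinct_sort set_sort)
  then show ?thesis by (rule that)
qed

theorem corollary15:
  "(\<forall>G :: 'a graph. permutation_graph G \<and> max_degree G \<ge> 1 \<longrightarrow>
      int (lambda21 G) \<le> 4 * int (max_degree G) - 1) \<and>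
   approximation_algorithm 4 (greedy :: 'a graph \<Rightarrow> 'a list \<Rightarrow> 'a \<Rightarrow> nat)"
proof (intro conjI allI impI)
  fix G :: "'a graph"
  assume G: "permutation_graph G \<and> max_degree G \<ge> 1"
  then have sg: "simple_graph G" by (simp add: permutation_graph_def)
  obtain vs where vs: "right_endpoint_ordering G vs" using G permutation_graph_ordering by blast
  have "lambda21 G \<le> 4 * max_degree G - 1"
    using greedy_L21_labeling[OF sg vs] lambda21_le_label_span le_trans by blast
  \<comment> \<open>Positive maximum degree makes the natural and the integer subtraction
    agree.\<close>
  with G show "int (lambda21 G) \<le> 4 * int (max_degree G) - 1" by linarith
next
  show "approximation_algorithm 4 (greedy :: 'a graph \<Rightarrow> 'a list \<Rightarrow> 'a \<Rightarrow> nat)"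
    unfolding approximation_algorithm_def
  proof (intro allI impI)
    fix G :: "'a graph" and vs
    assume G: "permutation_graph G \<and> right_endpoint_ordering G vs"
    then have sg: "simple_graph G" by (simp add: permutation_graph_def)
    note gr = greedy_L21_labeling[OF sg conjunct2[OF G]]
    obtain g where "L21_labeling G g" "label_span G g = lambda21 G"
      using lambda21_attained[OF gr(1)] by blast
    then have "max_degree G \<le> lambda21 G" using max_degree_le_label_span[OF sg] by force
    then show "L21_labeling G (greedy G vs) \<and> label_span G (greedy G vs) \<le> 4 * lambda21 G"
      using gr by linarith
  qed
qed

end
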